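(* Let $X\subseteq\mathbb{R}^d$ be a feature space and $Y$ a label space, and let $(\bm{x}_1,y_1),\dots,(\bm{x}_n,y_n),(\bm{x}_{n+1},y_{n+1})$ be i.i.d. samples from a distribution on $X\times Y$, where the first $n$ pairs form the calibration set and $(\bm{x}_{n+1},y_{n+1})$ is the (clean) test point. Let $S:X\times Y\to\mathbb{R}$ be a score function and $\alpha\in(0,1)$. Fix $\epsilon>0$ and a norm $\|\cdot\|_p$ on $\mathbb{R}^d$, with $B_\epsilon(\bm{x})=\{\bm{x}':\|\bm{x}'-\bm{x}\|_p\le\epsilon\}$. For each $i=1,\dots,n$ let $s^{\top}_i$ be any value with $$s^{\top}_i\ge\sup_{\bm{x}'\in B_\epsilon(\bm{x}_i)}S(\bm{x}',y_i),$$ and let $F^{\top}=\frac{\delta_\infty}{n+1}+\sum_{i=1}^n\frac{\delta_{s^{\top}_i}}{n+1}$, where $\delta_s$ is the Dirac distribution at $s$. Define $C_\epsilon(\bm{x})=\{y\in Y: S(\bm{x},y)\le Q_{1-\alpha}(F^{\top})\}$. Let $\tilde{\bm{x}}_{n+1}=\bm{x}_{n+1}+\bm{\delta}$ where $\bm{\delta}$ is any perturbation with $\|\bm{\delta}\|_p\le\epsilon$. Then $$\mathbb{P}\left[y_{n+1}\in C_\epsilon(\tilde{\bm{x}}_{n+1})\right]\ge1-\alpha.$$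
   Context: $Q_{1-\alpha}(F^{\top})$ denotes the $(1-\alpha)$-quantile of the distribution $F^{\top}$, i.e. $\inf\{q: F^{\top}((-\infty,q])\ge 1-\alpha\}$. The probability is taken over the calibration data and the test point. This construction is called "VRCP via Robust Calibration" (VRCP–C): upper bounds of the calibration scores over $\epsilon$-balls are used at calibration time, and the ordinary score is used at inference time. *)

theory Defs
  imports "HOL-Probability.Probability"
begin

text \<open>The \<open>\<ell>\<^sub>p\<close> norm on \<open>\<real>\<^sup>d\<close>; it is a norm for \<open>1 \<le> p \<le> \<infinity>\<close>.\<close>

definition lp_norm :: "ereal \<Rightarrow> real ^ 'd \<Rightarrow> real" where
  "lp_norm p x =
     (if p = \<infinity> then Max (range (\<lambda>i. \<bar>x $ i\<bar>))
      else (\<Sum>i\<in>UNIV. \<bar>x $ i\<bar> powr real_of_ereal p) powr (1 / real_of_ereal p))"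

text \<open>The score is defined on \<open>X \<times> Y\<close> only, so the ball is taken in the feature space \<open>X\<close>.
  For \<open>X = UNIV\<close> it is the ball of \<open>\<real>\<^sup>d\<close>.\<close>

definition lp_ball :: "(real ^ 'd) set \<Rightarrow> ereal \<Rightarrow> real \<Rightarrow> real ^ 'd \<Rightarrow> (real ^ 'd) set" where
  "lp_ball X p \<epsilon> x = {x' \<in> X. lp_norm p (x' - x) \<le> \<epsilon>}"

definition robust_score_distr :: "nat \<Rightarrow> (nat \<Rightarrow> ereal) \<Rightarrow> ereal measure" where
  "robust_score_distr n s = measure_of UNIV (sets borel)
     (\<lambda>A. (emeasure (return borel \<infinity>) A + (\<Sum>i=1..n. emeasure (return borel (s i)) A))
            / of_nat (n + 1))"

text \<open>\<open>measure_of\<close> yields the null measure on a set function that is not countably additive;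
  the following shows that this does not happen here.\<close>

lemma emeasure_robust_score_distr:
  assumes "A \<in> sets borel"
  shows "emeasure (robust_score_distr n s) A =
    (emeasure (return borel \<infinity>) A + (\<Sum>i=1..n. emeasure (return borel (s i)) A)) / of_nat (n + 1)"
proof (rule emeasure_measure_of[OF robust_score_distr_def])
  show "countably_additive (sets (robust_score_distr n s))
     (\<lambda>A. (emeasure (return borel \<infinity>) A + (\<Sum>i=1..n. emeasure (return borel (s i)) A))
            / of_nat (n + 1))"
  proof (rule countably_additiveI)
    fix B :: "nat \<Rightarrow> ereal set"
    assume B: "range B \<subseteq> sets (robust_score_distr n s)" "disjoint_family B"
    then have B': "range B \<subseteq> sets borel"
      by (simp add: robust_score_distr_def sets.sigma_sets_eq[of borel, simplified])
    have *: "(\<Sum>k. emeasure (return borel c) (B k)) = emeasure (return borel c) (\<Union>k. B k)"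
      for c :: ereal
      using B' B(2) by (intro suminf_emeasure) auto
    show "(\<Sum>k. (emeasure (return borel \<infinity>) (B k)
                + (\<Sum>i=1..n. emeasure (return borel (s i)) (B k))) / of_nat (n + 1))
      = (emeasure (return borel \<infinity>) (\<Union>k. B k)
                + (\<Sum>i=1..n. emeasure (return borel (s i)) (\<Union>k. B k))) / of_nat (n + 1)"
      by (simp only: ennreal_suminf_divide suminf_add[OF summableI summableI, symmetric]
            suminf_sum[OF summableI] *)
  qed
qed (use assms in \<open>auto simp: positive_def robust_score_distr_def
       sets.sigma_sets_eq[of borel, simplified]\<close>)

definition quantile :: "real \<Rightarrow> ereal measure \<Rightarrow> ereal" where
  "quantile \<beta> F = Inf {q. measure F {..q} \<ge> \<beta>}"

definition vrcp_c_set ::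
    "'y set \<Rightarrow> ((real ^ 'd) \<times> 'y \<Rightarrow> real) \<Rightarrow> real \<Rightarrow> nat \<Rightarrow> (nat \<Rightarrow> ereal) \<Rightarrow> real ^ 'd \<Rightarrow> 'y set" where
  "vrcp_c_set Y S \<alpha> n s x =
     {y \<in> Y. ereal (S (x, y)) \<le> quantile (1 - \<alpha>) (robust_score_distr n s)}"

text \<open>The data: the pairs \<open>1, \<dots>, n\<close> are the calibration set, the pair \<open>n + 1\<close> is the test
  point.\<close>

definition sample :: "nat \<Rightarrow> (nat \<Rightarrow> 'w \<Rightarrow> 'z) \<Rightarrow> 'w \<Rightarrow> nat \<Rightarrow> 'z" where
  "sample n Z \<omega> = (\<lambda>i\<in>{1..n+1}. Z i \<omega>)"

end

theory Submission
  imports Defs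
begin

text \<open>
  Let \<open>T (x, y)\<close> be the supremum of \<open>S (\<cdot>, y)\<close> over the ball around \<open>x\<close>. The perturbed test score is
  at most \<open>T\<close> of the clean test point and every calibration value is at least \<open>T\<close> of its
  calibration point, so the coverage event \<open>E\<close> contains the set \<open>G\<close> of samples on which the test
  value of \<open>T\<close> is at most the conformal quantile of the calibration values of \<open>T\<close>. For every sample,
  at least \<open>(1 - \<alpha>) (n + 1)\<close> of the \<open>n + 1\<close> transpositions of the test point with some point of the
  sample lead into \<open>G\<close>, hence into \<open>E\<close>. Integrating this count over the exchangeable sample gives
  the bound. No measurability of \<open>T\<close> or \<open>G\<close> enters, since only indicators of \<open>E\<close> are
  integrated.
\<close>

lemma measure_robust_score_distr_atMost:
  "measure (robust_score_distr n s) {..q} =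
     (of_bool (q = \<infinity>) + real (card {i \<in> {1..n}. s i \<le> q})) / real (n + 1)"
proof -
  have "emeasure (robust_score_distr n s) {..q} =
      (of_bool (q = \<infinity>) + of_nat (card {i \<in> {1..n}. s i \<le> q})) / of_nat (n + 1)"
  proof -
    have "(\<Sum>i=1..n. indicator {..q} (s i)) = (of_nat (card {i \<in> {1..n}. s i \<le> q}) :: ennreal)"
      by (simp add: indicator_def Int_def)
    moreover have "indicator {..q} \<infinity> = (of_bool (q = \<infinity>) :: ennreal)"
      by (auto simp: indicator_def)
    ultimately show ?thesis
      by (simp add: emeasure_robust_score_distr)
  qed
  also have "\<dots> = ennreal (of_bool (q = \<infinity>) + real (card {i \<in> {1..n}. s i \<le> q})) / ennreal (real (n + 1))"
    by (cases "q = \<infinity>") (simp_all add: ennreal_of_nat_eq_real_of_nat flip: ennreal_plus ennreal_1)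
  also have "\<dots> = ennreal ((of_bool (q = \<infinity>) + real (card {i \<in> {1..n}. s i \<le> q})) / real (n + 1))"
    by (rule divide_ennreal) auto
  finally show ?thesis
    by (simp add: measure_def)
qed

text \<open>Raising the atoms can only lower the mass of each \<open>{..q}\<close>, which shrinks
  the set whose infimum is the quantile.\<close>

lemma quantile_robust_score_distr_mono:
  assumes "\<And>i. i \<in> {1..n} \<Longrightarrow> s i \<le> t i"
  shows "quantile \<beta> (robust_score_distr n s) \<le> quantile \<beta> (robust_score_distr n t)"
proof -
  have "measure (robust_score_distr n t) {..q} \<le> measure (robust_score_distr n s) {..q}" for q
  proof -
    have "card {i \<in> {1..n}. t i \<le> q} \<le> card {i \<in> {1..n}. s i \<le> q}"
      using assms by (intro card_mono) (auto intro: order_trans)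
    then show ?thesis
      unfolding measure_robust_score_distr_atMost by (intro divide_right_mono) auto
  qed
  then show ?thesis
    unfolding quantile_def by (intro Inf_superset_mono) (auto intro: order_trans)
qed

text \<open>The transposition makes \<open>t j\<close> the test value and leaves the others for
  calibration. An index fails only if, for some \<open>q\<close> below \<open>t j\<close>, enough of
  the sample lies at or below \<open>q\<close>. Taking a failing index with least
  \<open>t j\<close>, all those points succeed, and they are numerous enough.\<close>

lemma card_le_quantile_transpose:
  fixes t :: "nat \<Rightarrow> ereal"
  assumes "\<beta> \<le> 1"
  shows "\<beta> * real (n + 1) \<le> real (card {j \<in> {1..n+1}.
           t j \<le> quantile \<beta> (robust_score_distr n (\<lambda>i. t (Transposition.transpose j (n+1) i)))})"
    (is "_ \<le> real (card ?good)")
proof -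
  define bad where "bad = {1..n+1} - ?good"
  have bad: "\<exists>q < t j. \<beta> * real (n + 1) \<le> real (card {i \<in> {1..n+1}. t i \<le> q})" if "j \<in> bad" for j
  proof -
    have j: "j \<in> {1..n+1}" using that by (simp add: bad_def)
    from that obtain q where q: "q < t j"
      and m: "\<beta> \<le> measure (robust_score_distr n (\<lambda>i. t (Transposition.transpose j (n+1) i))) {..q}"
      by (auto simp: bad_def quantile_def not_le Inf_less_iff)
    let ?A = "{i \<in> {1..n}. t (Transposition.transpose j (n+1) i) \<le> q}"
    \<comment> \<open>The atom at infinity has mass in \<open>{..q}\<close> only for infinite
      \<open>q\<close>, so here only calibration values count.\<close>
    have "q \<noteq> \<infinity>" using q by auto
    with m have "\<beta> \<le> real (card ?A) / real (n + 1)"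
      by (simp add: measure_robust_score_distr_atMost)
    then have "\<beta> * real (n + 1) \<le> real (card ?A)"
      by (subst (asm) pos_le_divide_eq) auto
    \<comment> \<open>The transposition maps calibration positions injectively to sample positions,
      which turns the count into one over the untransposed sample.\<close>
    also have "card ?A \<le> card {i \<in> {1..n+1}. t i \<le> q}"
    proof (rule card_inj_on_le[where f="Transposition.transpose j (n+1)"])
      show "Transposition.transpose j (n+1) ` ?A \<subseteq> {i \<in> {1..n+1}. t i \<le> q}"
        using j by (auto simp: Transposition.transpose_def)
    qed (auto intro: inj_on_subset[OF inj_transpose])
    finally show ?thesis using q by auto
  qed
  show ?thesis
  proof (cases "bad = {}")
    case True
    then have "?good = {1..n+1}" by (auto simp: bad_def)
    then have "card ?good = n + 1" by simp
    then show ?thesis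
      using mult_right_mono[OF assms, of "real (n + 1)"] by simp
  next
    case False
    have "finite bad" by (simp add: bad_def)
    then obtain j where j: "j \<in> bad" and min: "\<And>i. i \<in> bad \<Longrightarrow> t j \<le> t i"
      using arg_min_if_finite(1)[OF _ False, of t] arg_min_least[OF _ False, of _ t] by metis
    from bad[OF j] obtain q where q: "q < t j"
      and "\<beta> * real (n + 1) \<le> real (card {i \<in> {1..n+1}. t i \<le> q})" by blast
    note this(2)
    also have "card {i \<in> {1..n+1}. t i \<le> q} \<le> card ?good"
    proof (rule card_mono)
      \<comment> \<open>A failing \<open>i\<close> would give \<open>t j \<le> t i \<le> q\<close>,
        against \<open>q < t j\<close>.\<close>
      have "i \<notin> bad" if "t i \<le> q" for i
        using min[of i] q that by (meson leD order.trans)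
      then show "{i \<in> {1..n+1}. t i \<le> q} \<subseteq> ?good"
        unfolding bad_def by blast
    qed simp
    finally show ?thesis by simp
  qed
qed

text \<open>A product of equal factors is invariant under swapping coordinates, so every transposed
  sample lies in \<open>E\<close> with the same probability. The expected count of \<open>j\<close>
  is therefore \<open>card I\<close> times that probability, and a pointwise lower bound on the
  count survives integration.\<close>

lemma card_transpose_le_measure_PiM:
  assumes D: "prob_space D" and I: "finite I" "k \<in> I"
    and E: "E \<in> sets (\<Pi>\<^sub>M i\<in>I. D)"
    and count: "\<And>z. z \<in> space (\<Pi>\<^sub>M i\<in>I. D) \<Longrightarrow>
      c \<le> real (card {j \<in> I. (\<lambda>i\<in>I. z (Transposition.transpose j k i)) \<in> E})"
  shows "c \<le> real (card I) * measure (\<Pi>\<^sub>M i\<in>I. D) E"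
proof -
  let ?P = "\<Pi>\<^sub>M i\<in>I. D"
  let ?\<sigma> = "\<lambda>j z. \<lambda>i\<in>I. z (Transposition.transpose j k i)"
  interpret P: prob_space ?P
    using D by (intro prob_space_PiM)
  have maps: "Transposition.transpose j k \<in> I \<rightarrow> I" if "j \<in> I" for j
    using that I by (auto simp: Transposition.transpose_def)
  have meas: "?\<sigma> j \<in> measurable ?P ?P" if "j \<in> I" for j
    using maps[OF that] by (intro measurable_restrict measurable_component_singleton) auto
  have distr: "distr ?P ?P (?\<sigma> j) = ?P" if "j \<in> I" for j
    using distr_PiM_reindex[of I "\<lambda>_. D" "Transposition.transpose j k" I] D maps[OF that]
    by (auto intro: inj_on_subset[OF inj_transpose])
  let ?E = "\<lambda>j. ?\<sigma> j -` E \<inter> space ?P"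
  have E': "?E j \<in> sets ?P" if "j \<in> I" for j
    using measurable_sets[OF meas[OF that] E] .
  have m: "measure ?P (?E j) = measure ?P E" if "j \<in> I" for j
    using measure_distr[OF meas[OF that] E] distr[OF that] by simp
  have int: "integrable ?P (indicator (?E j) :: _ \<Rightarrow> real)" if "j \<in> I" for j
    using E'[OF that] by (simp add: P.emeasure_eq_measure)
  have "c = (\<integral>z. c \<partial>?P)" by (simp add: P.prob_space)
  also have "\<dots> \<le> (\<integral>z. (\<Sum>j\<in>I. indicator (?E j) z) \<partial>?P)"
  proof (rule integral_mono)
    fix z assume z: "z \<in> space ?P"
    have "(\<Sum>j\<in>I. indicator (?E j) z :: real) = (\<Sum>j\<in>I. of_bool (?\<sigma> j z \<in> E))"
      using z by (intro sum.cong) (auto simp: indicator_def)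
    also have "\<dots> = real (card {j \<in> I. ?\<sigma> j z \<in> E})"
      using I by (simp add: Int_def)
    finally show "c \<le> (\<Sum>j\<in>I. indicator (?E j) z)"
      using count[OF z] by simp
  qed (use int in auto)
  also have "\<dots> = (\<Sum>j\<in>I. measure ?P (?E j))"
    using int by (simp add: Bochner_Integration.integral_sum Int_absorb2)
  also have "\<dots> = real (card I) * measure ?P E"
    using m by simp
  finally show ?thesis .
qed

theorem theorem2:
  fixes X :: "(real ^ 'd) set" and Y :: "'y set"
    and D :: "((real ^ 'd) \<times> 'y) measure"
    and M :: "'w measure" and Z :: "nat \<Rightarrow> 'w \<Rightarrow> (real ^ 'd) \<times> 'y"
    and n :: nat and \<alpha> \<epsilon> :: real and p :: ereal
    and S :: "(real ^ 'd) \<times> 'y \<Rightarrow> real"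
    and s :: "(nat \<Rightarrow> (real ^ 'd) \<times> 'y) \<Rightarrow> nat \<Rightarrow> ereal"
    and \<delta> :: "(nat \<Rightarrow> (real ^ 'd) \<times> 'y) \<Rightarrow> real ^ 'd"
  assumes distribution: "prob_space D" "space D = X \<times> Y"
    and probability_space: "prob_space M"
    and independent: "prob_space.indep_vars M (\<lambda>_. D) Z {1..n+1}"
    and identically_distributed: "\<And>i. i \<in> {1..n+1} \<Longrightarrow> distr M D (Z i) = D"
    and "0 < \<alpha>" "\<alpha> < 1" "0 < \<epsilon>" "1 \<le> p"
    and upper_bounds: "\<And>z i. z \<in> space (\<Pi>\<^sub>M i\<in>{1..n+1}. D) \<Longrightarrow> i \<in> {1..n} \<Longrightarrow>
          s z i \<ge> (SUP x'\<in>lp_ball X p \<epsilon> (fst (z i)). ereal (S (x', snd (z i))))"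
    and perturbation: "\<And>z. z \<in> space (\<Pi>\<^sub>M i\<in>{1..n+1}. D) \<Longrightarrow>
          lp_norm p (\<delta> z) \<le> \<epsilon> \<and> fst (z (n+1)) + \<delta> z \<in> X"
    and measurable_event: "{z \<in> space (\<Pi>\<^sub>M i\<in>{1..n+1}. D).
          snd (z (n+1)) \<in> vrcp_c_set Y S \<alpha> n (s z) (fst (z (n+1)) + \<delta> z)}
            \<in> sets (\<Pi>\<^sub>M i\<in>{1..n+1}. D)"
  shows "\<P>(\<omega> in M. snd (Z (n+1) \<omega>) \<in>
           vrcp_c_set Y S \<alpha> n (s (sample n Z \<omega>)) (fst (Z (n+1) \<omega>) + \<delta> (sample n Z \<omega>)))
         \<ge> 1 - \<alpha>"
proof -
  let ?I = "{1..n+1}"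
  let ?P = "\<Pi>\<^sub>M i\<in>?I. D"
  define E where "E = {z \<in> space ?P.
    snd (z (n+1)) \<in> vrcp_c_set Y S \<alpha> n (s z) (fst (z (n+1)) + \<delta> z)}"
  \<comment> \<open>The bounds \<open>s z i\<close> may depend on the index and on the whole sample,
    so they need not be exchangeable. \<open>T\<close> is one fixed function of a single pair, to
    which swapping applies.\<close>
  define T where "T = (\<lambda>v. SUP x'\<in>lp_ball X p \<epsilon> (fst v). ereal (S (x', snd v)))"
  interpret M: prob_space M by fact
  have E: "E \<in> sets ?P" using measurable_event by (simp add: E_def)
  have in_E: "z \<in> E" if z: "z \<in> space ?P"
    and le: "T (z (n+1)) \<le> quantile (1 - \<alpha>) (robust_score_distr n (\<lambda>i. T (z i)))" for z
  proof -
    have "z (n+1) \<in> X \<times> Y"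
      using z distribution(2) by (auto simp: space_PiM PiE_def Pi_def)
    then have y: "snd (z (n+1)) \<in> Y" by auto
    have "fst (z (n+1)) + \<delta> z \<in> lp_ball X p \<epsilon> (fst (z (n+1)))"
      using perturbation[OF z] by (simp add: lp_ball_def)
    then have "ereal (S (fst (z (n+1)) + \<delta> z, snd (z (n+1)))) \<le> T (z (n+1))"
      unfolding T_def by (rule SUP_upper)
    also note le
    also have "quantile (1 - \<alpha>) (robust_score_distr n (\<lambda>i. T (z i)))
        \<le> quantile (1 - \<alpha>) (robust_score_distr n (s z))"
      using upper_bounds[OF z] by (intro quantile_robust_score_distr_mono) (simp add: T_def)
    finally show ?thesis using y z by (simp add: E_def vrcp_c_set_def)
  qed
  have "(1 - \<alpha>) * real (n + 1) \<le> real (card ?I) * measure ?P E"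
  proof (rule card_transpose_le_measure_PiM[OF distribution(1) _ _ E])
    fix z assume z: "z \<in> space ?P"
    let ?\<sigma> = "\<lambda>j. \<lambda>i\<in>?I. z (Transposition.transpose j (n+1) i)"
    let ?Q = "\<lambda>t. quantile (1 - \<alpha>) (robust_score_distr n t)"
    \<comment> \<open>The counting bound is applied to the values \<open>T (z i)\<close> of one
      fixed sample.\<close>
    have "(1 - \<alpha>) * real (n + 1) \<le> real (card {j \<in> ?I.
        T (z j) \<le> ?Q (\<lambda>i. T (z (Transposition.transpose j (n+1) i)))})"
      using \<open>0 < \<alpha>\<close> by (intro card_le_quantile_transpose) simp
    also have "card {j \<in> ?I. T (z j) \<le> ?Q (\<lambda>i. T (z (Transposition.transpose j (n+1) i)))}
        \<le> card {j \<in> ?I. ?\<sigma> j \<in> E}"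
    proof (intro card_mono subsetI)
      fix j assume "j \<in> {j \<in> ?I. T (z j) \<le> ?Q (\<lambda>i. T (z (Transposition.transpose j (n+1) i)))}"
      then have j: "j \<in> ?I" and le: "T (z j) \<le> ?Q (\<lambda>i. T (z (Transposition.transpose j (n+1) i)))" by auto
      have "Transposition.transpose j (n+1) i \<in> ?I" if "i \<in> ?I" for i
        using j that by (auto simp: Transposition.transpose_def)
      then have "?\<sigma> j \<in> space ?P"
        using z by (auto simp: space_PiM PiE_def Pi_def)
      \<comment> \<open>Position \<open>n+1\<close> of the swapped sample holds \<open>z j\<close>.
        The quantile reads only positions \<open>1\<close> to \<open>n\<close>, where restricting to
        \<open>?I\<close> changes nothing.\<close>
      moreover have "T (?\<sigma> j (n+1)) \<le> ?Q (\<lambda>i. T (?\<sigma> j i))"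
      proof -
        have "?Q (\<lambda>i. T (z (Transposition.transpose j (n+1) i))) \<le> ?Q (\<lambda>i. T (?\<sigma> j i))"
          by (intro quantile_robust_score_distr_mono) simp
        with le show ?thesis by simp
      qed
      ultimately show "j \<in> {j \<in> ?I. ?\<sigma> j \<in> E}" using in_E j by blast
    qed simp
    finally show "(1 - \<alpha>) * real (n + 1) \<le> real (card {j \<in> ?I. ?\<sigma> j \<in> E})" by simp
  qed auto
  then have bound: "1 - \<alpha> \<le> measure ?P E"
    by (simp add: mult.commute)
  have rv: "Z i \<in> measurable M D" if "i \<in> ?I" for i
    using independent that by (auto simp: M.indep_vars_def)
  \<comment> \<open>Independence makes the joint law the product of the marginals, all equal to
    \<open>D\<close>, so the bound for \<open>E\<close> carries over to \<open>M\<close>.\<close>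
  have "distr M ?P (sample n Z) = (\<Pi>\<^sub>M i\<in>?I. distr M D (Z i))"
    using M.indep_vars_iff_distr_eq_PiM'[where I="?I" and M'="\<lambda>_. D" and X=Z] independent rv
    by (simp add: sample_def[abs_def])
  also have "\<dots> = ?P"
    using identically_distributed by (intro PiM_cong) auto
  finally have distr: "distr M ?P (sample n Z) = ?P" .
  have sample: "sample n Z \<in> measurable M ?P"
    unfolding sample_def[abs_def] using rv by (intro measurable_restrict) auto
  have "measure ?P E = measure M (sample n Z -` E \<inter> space M)"
    using measure_distr[OF sample E] distr by simp
  also have "sample n Z -` E \<inter> space M = {\<omega> \<in> space M. snd (Z (n+1) \<omega>) \<in>
      vrcp_c_set Y S \<alpha> n (s (sample n Z \<omega>)) (fst (Z (n+1) \<omega>) + \<delta> (sample n Z \<omega>))}"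
    using measurable_space[OF sample] by (auto simp: E_def) (auto simp: sample_def)
  finally show ?thesis using bound by simp
qed

end
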